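(* Let $Q$ be a quantale. The following conditions are equivalent: (1) $Q$ is a simple quantale; (2) $Q$ is a strictly faithful factor; (3) $Q$ has a subset which is both separating and cyclic.
   Context: A sup-lattice is a complete lattice, with top $1$ and bottom $0$; a sup-lattice morphism is a map preserving arbitrary joins. A quantale is a sup-lattice $Q$ with an associative multiplication satisfying $a(\bigvee a_i)=\bigvee(aa_i)$ and $(\bigvee a_i)a=\bigvee(a_ia)$ (no unit is assumed). A quantale morphism is a sup-lattice morphism preserving multiplication. A congruence on $Q$ is an equivalence relation compatible with multiplication on both sides and with arbitrary joins. An element $a\in Q$ is right-sided if $a1\le a$, left-sided if $1a\le a$, two-sided if both; $\mathcal{R}(Q)$, $\mathcal{L}(Q)$, $\mathcal{T}(Q)$ are the sets of right-sided, left-sided and two-sided elements. $Q$ is simple if $1\cdot 1\neq 0$ and every quotient (surjective) morphism from $Q$ is either an isomorphism or a constant morphism onto a trivial (one-element) quantale; in other words, there are exactly two congruences on $Q$. $Q$ is a factor if $\mathcal{T}(Q)=\{0,1\}$ and $0\neq 1$. $Q$ is strictly faithful if for all $a,b\in Q$: whenever $lar=lbr$ for all $l\in\mathcal{L}(Q)$ and all $r\in\mathcal{R}(Q)$, then $a=b$. Residuations: $b\to c=\bigvee\{a\mid ab\le c\}$ and $c\leftarrow a=\bigvee\{b\mid ab\le c\}$, so $a\le b\to c\iff ab\le c\iff b\le c\leftarrow a$. One has $(b\to c)\leftarrow a=b\to(c\leftarrow a)$, written $b\to c\leftarrow a$. A set $P\subseteq Q$ is separating if for all $a,b\in Q$ with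 $a\not\geq b$ there is $p\in P$ with $a\le p$ and $b\not\le p$. A nonempty set $P\subseteq Q$ with $1\notin P$ is cyclic if $\{a\to p\leftarrow b\mid a,b\in Q\}=P\cup\{1\}$ for every $p\in P$. *)

theory Defs
  imports "HOL-Algebra.Complete_Lattice"
begin

section \<open>Quantales\<close>

text \<open>
  The top element \<open>1\<close> of the source is written \<open>\<top>\<close> and the bottom element \<open>0\<close> is written
  \<open>\<bottom>\<close>; in particular \<open>\<top>\<close> is not assumed to be a multiplicative unit.
\<close>

record 'a quantale = "'a gorder" +
  mult :: "['a, 'a] \<Rightarrow> 'a" (infixl \<open>\<otimes>\<index>\<close> 70)

locale quantale = complete_lattice Q for Q (structure) +
  assumes mult_closed: "\<lbrakk>a \<in> carrier Q; b \<in> carrier Q\<rbrakk> \<Longrightarrow> a \<otimes> b \<in> carrier Q"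
    and mult_assoc:
      "\<lbrakk>a \<in> carrier Q; b \<in> carrier Q; c \<in> carrier Q\<rbrakk> \<Longrightarrow> (a \<otimes> b) \<otimes> c = a \<otimes> (b \<otimes> c)"
    and mult_sup_right:
      "\<lbrakk>a \<in> carrier Q; A \<subseteq> carrier Q\<rbrakk> \<Longrightarrow> a \<otimes> \<Squnion>A = \<Squnion>((\<lambda>x. a \<otimes> x) ` A)"
    and mult_sup_left:
      "\<lbrakk>a \<in> carrier Q; A \<subseteq> carrier Q\<rbrakk> \<Longrightarrow> \<Squnion>A \<otimes> a = \<Squnion>((\<lambda>x. x \<otimes> a) ` A)"

definition quantale_hom ::
    "('a, 'm) quantale_scheme \<Rightarrow> ('b, 'n) quantale_scheme \<Rightarrow> ('a \<Rightarrow> 'b) set"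
  where "quantale_hom Q R =
    {f \<in> carrier Q \<rightarrow> carrier R. sup_pres Q R f \<and>
      (\<forall>a\<in>carrier Q. \<forall>b\<in>carrier Q. f (a \<otimes>\<^bsub>Q\<^esub> b) = f a \<otimes>\<^bsub>R\<^esub> f b)}"

definition quantale_iso ::
    "('a, 'm) quantale_scheme \<Rightarrow> ('b, 'n) quantale_scheme \<Rightarrow> ('a \<Rightarrow> 'b) set"
  where "quantale_iso Q R = {f \<in> quantale_hom Q R. bij_betw f (carrier Q) (carrier R)}"

text \<open>A family of congruent pairs is given as a set \<open>S\<close> of pairs.\<close>

definition quantale_congruence :: "('a, 'm) quantale_scheme \<Rightarrow> ('a \<times> 'a) set \<Rightarrow> bool"
  where "quantale_congruence Q \<theta> \<longleftrightarrow>
    \<theta> \<subseteq> carrier Q \<times> carrier Q \<and> equiv (carrier Q) \<theta> \<and>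
    (\<forall>(a, b)\<in>\<theta>. \<forall>c\<in>carrier Q. (c \<otimes>\<^bsub>Q\<^esub> a, c \<otimes>\<^bsub>Q\<^esub> b) \<in> \<theta> \<and> (a \<otimes>\<^bsub>Q\<^esub> c, b \<otimes>\<^bsub>Q\<^esub> c) \<in> \<theta>) \<and>
    (\<forall>S\<subseteq>\<theta>. (\<Squnion>\<^bsub>Q\<^esub>(fst ` S), \<Squnion>\<^bsub>Q\<^esub>(snd ` S)) \<in> \<theta>)"

text \<open>
  The quotients \<open>R\<close> range over quantales whose carrier is a set of elements of the same type as
  those of \<open>Q\<close>. This is no restriction, since the image of a morphism from \<open>Q\<close> is in bijection
  with a set of representatives in \<open>Q\<close>; see \<open>simple_quantale_any_type\<close>
  and \<open>simple_quantale_iff_congruences\<close> below.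
\<close>

definition simple_quantale :: "('a, 'm) quantale_scheme \<Rightarrow> bool"
  where "simple_quantale Q \<longleftrightarrow>
    \<top>\<^bsub>Q\<^esub> \<otimes>\<^bsub>Q\<^esub> \<top>\<^bsub>Q\<^esub> \<noteq> \<bottom>\<^bsub>Q\<^esub> \<and>
    (\<forall>(R :: 'a quantale) f. quantale R \<longrightarrow> f \<in> quantale_hom Q R \<longrightarrow> f ` carrier Q = carrier R \<longrightarrow>
      f \<in> quantale_iso Q R \<or> (\<exists>c. carrier R = {c}))"

definition right_sided :: "('a, 'm) quantale_scheme \<Rightarrow> 'a set"
  where "right_sided Q = {a \<in> carrier Q. a \<otimes>\<^bsub>Q\<^esub> \<top>\<^bsub>Q\<^esub> \<sqsubseteq>\<^bsub>Q\<^esub> a}"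

definition left_sided :: "('a, 'm) quantale_scheme \<Rightarrow> 'a set"
  where "left_sided Q = {a \<in> carrier Q. \<top>\<^bsub>Q\<^esub> \<otimes>\<^bsub>Q\<^esub> a \<sqsubseteq>\<^bsub>Q\<^esub> a}"

definition two_sided :: "('a, 'm) quantale_scheme \<Rightarrow> 'a set"
  where "two_sided Q = right_sided Q \<inter> left_sided Q"

definition factor :: "('a, 'm) quantale_scheme \<Rightarrow> bool"
  where "factor Q \<longleftrightarrow> two_sided Q = {\<bottom>\<^bsub>Q\<^esub>, \<top>\<^bsub>Q\<^esub>} \<and> \<bottom>\<^bsub>Q\<^esub> \<noteq> \<top>\<^bsub>Q\<^esub>"

definition strictly_faithful :: "('a, 'm) quantale_scheme \<Rightarrow> bool"
  where "strictly_faithful Q \<longleftrightarrow>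
    (\<forall>a\<in>carrier Q. \<forall>b\<in>carrier Q.
      (\<forall>l\<in>left_sided Q. \<forall>r\<in>right_sided Q. l \<otimes>\<^bsub>Q\<^esub> a \<otimes>\<^bsub>Q\<^esub> r = l \<otimes>\<^bsub>Q\<^esub> b \<otimes>\<^bsub>Q\<^esub> r) \<longrightarrow> a = b)"

text \<open>\<open>res_to Q b c\<close> is \<open>b \<rightarrow> c\<close> and \<open>res_from Q c a\<close> is \<open>c \<leftarrow> a\<close>.\<close>

definition res_to :: "('a, 'm) quantale_scheme \<Rightarrow> 'a \<Rightarrow> 'a \<Rightarrow> 'a"
  where "res_to Q b c = \<Squnion>\<^bsub>Q\<^esub>{a \<in> carrier Q. a \<otimes>\<^bsub>Q\<^esub> b \<sqsubseteq>\<^bsub>Q\<^esub> c}"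

definition res_from :: "('a, 'm) quantale_scheme \<Rightarrow> 'a \<Rightarrow> 'a \<Rightarrow> 'a"
  where "res_from Q c a = \<Squnion>\<^bsub>Q\<^esub>{b \<in> carrier Q. a \<otimes>\<^bsub>Q\<^esub> b \<sqsubseteq>\<^bsub>Q\<^esub> c}"

definition separating :: "('a, 'm) quantale_scheme \<Rightarrow> 'a set \<Rightarrow> bool"
  where "separating Q P \<longleftrightarrow> P \<subseteq> carrier Q \<and>
    (\<forall>a\<in>carrier Q. \<forall>b\<in>carrier Q. \<not> b \<sqsubseteq>\<^bsub>Q\<^esub> a \<longrightarrow> (\<exists>p\<in>P. a \<sqsubseteq>\<^bsub>Q\<^esub> p \<and> \<not> b \<sqsubseteq>\<^bsub>Q\<^esub> p))"

definition cyclic :: "('a, 'm) quantale_scheme \<Rightarrow> 'a set \<Rightarrow> bool"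
  where "cyclic Q P \<longleftrightarrow> P \<subseteq> carrier Q \<and> P \<noteq> {} \<and> \<top>\<^bsub>Q\<^esub> \<notin> P \<and>
    (\<forall>p\<in>P. {res_from Q (res_to Q a p) b | a b. a \<in> carrier Q \<and> b \<in> carrier Q} = P \<union> {\<top>\<^bsub>Q\<^esub>})"


section \<open>Residuation laws\<close>

context quantale
begin

lemma mult_mono_right:
  assumes "a \<in> carrier Q" "b \<in> carrier Q" "c \<in> carrier Q" "b \<sqsubseteq> c"
  shows "a \<otimes> b \<sqsubseteq> a \<otimes> c"
proof -
  have "\<Squnion>{b, c} = c"
    using assms by (intro le_antisym sup_least sup_upper sup_closed) auto
  then have "a \<otimes> c = \<Squnion>{a \<otimes> b, a \<otimes> c}"
    using mult_sup_right[of a "{b, c}"] assms by simp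
  then show ?thesis
    using sup_upper[of "{a \<otimes> b, a \<otimes> c}" "a \<otimes> b"] assms mult_closed by auto
qed

lemma mult_mono_left:
  assumes "a \<in> carrier Q" "b \<in> carrier Q" "c \<in> carrier Q" "b \<sqsubseteq> c"
  shows "b \<otimes> a \<sqsubseteq> c \<otimes> a"
proof -
  have "\<Squnion>{b, c} = c"
    using assms by (intro le_antisym sup_least sup_upper sup_closed) auto
  then have "c \<otimes> a = \<Squnion>{b \<otimes> a, c \<otimes> a}"
    using mult_sup_left[of a "{b, c}"] assms by simp
  then show ?thesis
    using sup_upper[of "{b \<otimes> a, c \<otimes> a}" "b \<otimes> a"] assms mult_closed by auto
qed

lemma res_to_closed [simp]: "res_to Q b c \<in> carrier Q"
  unfolding res_to_def by (rule sup_closed) auto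

lemma res_from_closed [simp]: "res_from Q c a \<in> carrier Q"
  unfolding res_from_def by (rule sup_closed) auto

lemma le_res_to_iff:
  assumes "a \<in> carrier Q" "b \<in> carrier Q" "c \<in> carrier Q"
  shows "a \<sqsubseteq> res_to Q b c \<longleftrightarrow> a \<otimes> b \<sqsubseteq> c"
proof
  let ?A = "{a \<in> carrier Q. a \<otimes> b \<sqsubseteq> c}"
  assume "a \<sqsubseteq> res_to Q b c"
  then have "a \<otimes> b \<sqsubseteq> res_to Q b c \<otimes> b"
    using assms by (intro mult_mono_left) auto
  moreover have "res_to Q b c \<otimes> b = \<Squnion>((\<lambda>x. x \<otimes> b) ` ?A)"
    unfolding res_to_def using assms by (intro mult_sup_left) auto
  moreover have "\<Squnion>((\<lambda>x. x \<otimes> b) ` ?A) \<sqsubseteq> c"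
    using assms mult_closed by (intro sup_least) auto
  ultimately have "a \<otimes> b \<sqsubseteq> res_to Q b c \<otimes> b" "res_to Q b c \<otimes> b \<sqsubseteq> c"
    by simp_all
  then show "a \<otimes> b \<sqsubseteq> c"
    using le_trans[of "a \<otimes> b" "res_to Q b c \<otimes> b" c] assms by (simp add: mult_closed)
next
  assume "a \<otimes> b \<sqsubseteq> c"
  then show "a \<sqsubseteq> res_to Q b c"
    unfolding res_to_def using assms by (intro sup_upper) auto
qed

lemma le_res_from_iff:
  assumes "a \<in> carrier Q" "b \<in> carrier Q" "c \<in> carrier Q"
  shows "b \<sqsubseteq> res_from Q c a \<longleftrightarrow> a \<otimes> b \<sqsubseteq> c"
proof
  let ?A = "{b \<in> carrier Q. a \<otimes> b \<sqsubseteq> c}"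
  assume "b \<sqsubseteq> res_from Q c a"
  then have "a \<otimes> b \<sqsubseteq> a \<otimes> res_from Q c a"
    using assms by (intro mult_mono_right) auto
  moreover have "a \<otimes> res_from Q c a = \<Squnion>((\<lambda>x. a \<otimes> x) ` ?A)"
    unfolding res_from_def using assms by (intro mult_sup_right) auto
  moreover have "\<Squnion>((\<lambda>x. a \<otimes> x) ` ?A) \<sqsubseteq> c"
    using assms mult_closed by (intro sup_least) auto
  ultimately have "a \<otimes> b \<sqsubseteq> a \<otimes> res_from Q c a" "a \<otimes> res_from Q c a \<sqsubseteq> c"
    by simp_all
  then show "a \<otimes> b \<sqsubseteq> c"
    using le_trans[of "a \<otimes> b" "a \<otimes> res_from Q c a" c] assms by (simp add: mult_closed)
next
  assume "a \<otimes> b \<sqsubseteq> c"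
  then show "b \<sqsubseteq> res_from Q c a"
    unfolding res_from_def using assms by (intro sup_upper) auto
qed

lemma res_to_res_from:
  assumes "a \<in> carrier Q" "b \<in> carrier Q" "c \<in> carrier Q"
  shows "res_from Q (res_to Q b c) a = res_to Q b (res_from Q c a)"
proof -
  have "x \<sqsubseteq> res_from Q (res_to Q b c) a \<longleftrightarrow> x \<sqsubseteq> res_to Q b (res_from Q c a)"
    if "x \<in> carrier Q" for x
    using that assms by (simp add: le_res_from_iff le_res_to_iff mult_closed mult_assoc)
  from this[of "res_from Q (res_to Q b c) a"] this[of "res_to Q b (res_from Q c a)"]
  show ?thesis
    by (intro le_antisym) simp_all
qed

end


section \<open>Quotients and congruences\<close>

lemma quantale_hom_closed:
  "\<lbrakk>f \<in> quantale_hom Q R; a \<in> carrier Q\<rbrakk> \<Longrightarrow> f a \<in> carrier R"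
  by (auto simp: quantale_hom_def)

lemma quantale_hom_sup:
  "\<lbrakk>f \<in> quantale_hom Q R; A \<subseteq> carrier Q\<rbrakk> \<Longrightarrow> f (\<Squnion>\<^bsub>Q\<^esub>A) = \<Squnion>\<^bsub>R\<^esub>(f ` A)"
  by (auto simp: quantale_hom_def sup_pres_def)

lemma quantale_hom_mult:
  "\<lbrakk>f \<in> quantale_hom Q R; a \<in> carrier Q; b \<in> carrier Q\<rbrakk> \<Longrightarrow> f (a \<otimes>\<^bsub>Q\<^esub> b) = f a \<otimes>\<^bsub>R\<^esub> f b"
  by (auto simp: quantale_hom_def)

definition hom_kernel :: "('a, 'm) quantale_scheme \<Rightarrow> ('a \<Rightarrow> 'b) \<Rightarrow> ('a \<times> 'a) set"
  where "hom_kernel Q f = {(a, b). a \<in> carrier Q \<and> b \<in> carrier Q \<and> f a = f b}"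

context quantale
begin

lemma quantale_congruence_hom_kernel:
  assumes f: "f \<in> quantale_hom Q R"
  shows "quantale_congruence Q (hom_kernel Q f)"
  unfolding quantale_congruence_def
proof (intro conjI allI impI)
  let ?K = "hom_kernel Q f"
  show "?K \<subseteq> carrier Q \<times> carrier Q"
    by (auto simp: hom_kernel_def)
  show "equiv (carrier Q) ?K"
    by (auto simp: hom_kernel_def equiv_def refl_on_def sym_def trans_def)
  show "\<forall>(a, b)\<in>?K. \<forall>c\<in>carrier Q. (c \<otimes> a, c \<otimes> b) \<in> ?K \<and> (a \<otimes> c, b \<otimes> c) \<in> ?K"
    using mult_closed quantale_hom_mult[OF f] by (auto simp: hom_kernel_def)
  fix S assume S: "S \<subseteq> ?K"
  then have sub: "fst ` S \<subseteq> carrier Q" "snd ` S \<subseteq> carrier Q"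
    by (auto simp: hom_kernel_def)
  have "f ` fst ` S = f ` snd ` S"
    using S unfolding image_image by (intro image_cong) (auto simp: hom_kernel_def)
  then show "(\<Squnion>(fst ` S), \<Squnion>(snd ` S)) \<in> ?K"
    using sub by (simp add: hom_kernel_def quantale_hom_sup[OF f])
qed

lemma hom_kernel_total:
  assumes "hom_kernel Q f = carrier Q \<times> carrier Q"
  shows "f ` carrier Q = {f \<top>}"
proof -
  have "f x = f \<top>" if "x \<in> carrier Q" for x
  proof -
    have "(x, \<top>) \<in> hom_kernel Q f" using assms that by simp
    then show ?thesis by (simp add: hom_kernel_def)
  qed
  then have "f ` carrier Q = (\<lambda>_. f \<top>) ` carrier Q" by (rule image_cong[OF HOL.refl])
  also have "\<dots> = {f \<top>}" by (rule image_constant[OF top_closed])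
  finally show ?thesis .
qed

lemma quantale_congruence_Id: "quantale_congruence Q (Id_on (carrier Q))"
  unfolding quantale_congruence_def
proof (intro conjI allI impI)
  show "equiv (carrier Q) (Id_on (carrier Q))"
    by (auto simp: equiv_def refl_on_def sym_def trans_def)
  fix S assume S: "S \<subseteq> Id_on (carrier Q)"
  then have "fst ` S = snd ` S"
    by (intro image_cong) auto
  moreover have "snd ` S \<subseteq> carrier Q"
    using S by auto
  ultimately show "(\<Squnion>(fst ` S), \<Squnion>(snd ` S)) \<in> Id_on (carrier Q)"
    by auto
qed (auto simp: mult_closed)

lemma quantale_congruence_total: "quantale_congruence Q (carrier Q \<times> carrier Q)"
  unfolding quantale_congruence_def
proof (intro conjI allI impI)
  show "equiv (carrier Q) (carrier Q \<times> carrier Q)"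
    by (auto simp: equiv_def refl_on_def sym_def trans_def)
  fix S assume "S \<subseteq> carrier Q \<times> carrier Q"
  then show "(\<Squnion>(fst ` S), \<Squnion>(snd ` S)) \<in> carrier Q \<times> carrier Q"
    by (auto intro!: sup_closed)
qed (auto simp: mult_closed)

end

text \<open>
  The quotient by a congruence is realised on the largest elements of the congruence classes.
\<close>

definition class_max :: "('a, 'm) quantale_scheme \<Rightarrow> ('a \<times> 'a) set \<Rightarrow> 'a \<Rightarrow> 'a"
  where "class_max Q \<theta> x = \<Squnion>\<^bsub>Q\<^esub>(\<theta> `` {x})"

definition quotient_quantale :: "('a, 'm) quantale_scheme \<Rightarrow> ('a \<times> 'a) set \<Rightarrow> 'a quantale"
  where "quotient_quantale Q \<theta> =
    \<lparr>carrier = class_max Q \<theta> ` carrier Q, eq = (=), le = le Q,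
     mult = (\<lambda>a b. class_max Q \<theta> (a \<otimes>\<^bsub>Q\<^esub> b))\<rparr>"

locale quantale_with_congruence = quantale +
  fixes \<theta> :: "('a \<times> 'a) set"
  assumes congruence: "quantale_congruence Q \<theta>"
begin

abbreviation "j \<equiv> class_max Q \<theta>"
abbreviation "R \<equiv> quotient_quantale Q \<theta>"

lemma cong_carrier: "(x, y) \<in> \<theta> \<Longrightarrow> x \<in> carrier Q \<and> y \<in> carrier Q"
  using congruence by (auto simp: quantale_congruence_def)

lemma cong_subset: "\<theta> \<subseteq> carrier Q \<times> carrier Q"
  using congruence by (auto simp: quantale_congruence_def)

lemma cong_equiv: "equiv (carrier Q) \<theta>"
  using congruence by (auto simp: quantale_congruence_def)

lemma cong_refl: "x \<in> carrier Q \<Longrightarrow> (x, x) \<in> \<theta>"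
  using cong_equiv by (auto simp: equiv_def refl_on_def)

lemma cong_sym: "(x, y) \<in> \<theta> \<Longrightarrow> (y, x) \<in> \<theta>"
  using cong_equiv by (auto simp: equiv_def sym_def)

lemma cong_trans: "(x, y) \<in> \<theta> \<Longrightarrow> (y, z) \<in> \<theta> \<Longrightarrow> (x, z) \<in> \<theta>"
  using cong_equiv unfolding equiv_def trans_def by blast

lemma cong_mult_left: "(x, y) \<in> \<theta> \<Longrightarrow> c \<in> carrier Q \<Longrightarrow> (c \<otimes> x, c \<otimes> y) \<in> \<theta>"
  using congruence by (auto simp: quantale_congruence_def)

lemma cong_mult_right: "(x, y) \<in> \<theta> \<Longrightarrow> c \<in> carrier Q \<Longrightarrow> (x \<otimes> c, y \<otimes> c) \<in> \<theta>"
  using congruence by (auto simp: quantale_congruence_def)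

lemma cong_sup: "S \<subseteq> \<theta> \<Longrightarrow> (\<Squnion>(fst ` S), \<Squnion>(snd ` S)) \<in> \<theta>"
  using congruence by (auto simp: quantale_congruence_def)

lemma cong_sup_image:
  assumes "\<And>x. x \<in> A \<Longrightarrow> (f x, g x) \<in> \<theta>"
  shows "(\<Squnion>(f ` A), \<Squnion>(g ` A)) \<in> \<theta>"
  using cong_sup[of "(\<lambda>x. (f x, g x)) ` A"] assms by (auto simp: image_image)

lemma j_cong: assumes x: "x \<in> carrier Q" shows "(x, j x) \<in> \<theta>"
proof -
  have "(\<Squnion>((\<lambda>_. x) ` (\<theta> `` {x})), \<Squnion>((\<lambda>y. y) ` (\<theta> `` {x}))) \<in> \<theta>"
    by (rule cong_sup_image) auto
  moreover have "(\<lambda>_. x) ` (\<theta> `` {x}) = {x}"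
    using cong_refl[OF x] by auto
  ultimately show ?thesis
    using x by (simp add: class_max_def)
qed

lemma j_closed: "x \<in> carrier Q \<Longrightarrow> j x \<in> carrier Q"
  using j_cong cong_carrier by blast

lemma j_greatest: "(x, y) \<in> \<theta> \<Longrightarrow> y \<sqsubseteq> j x"
  unfolding class_max_def using cong_carrier by (intro sup_upper) auto

lemma j_increasing: "x \<in> carrier Q \<Longrightarrow> x \<sqsubseteq> j x"
  using j_greatest cong_refl by blast

lemma j_eq_iff:
  assumes "x \<in> carrier Q" "y \<in> carrier Q"
  shows "j x = j y \<longleftrightarrow> (x, y) \<in> \<theta>"
proof
  assume "j x = j y"
  then show "(x, y) \<in> \<theta>"
    using j_cong assms by (metis cong_sym cong_trans)
next
  assume "(x, y) \<in> \<theta>"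
  then have "\<theta> `` {x} = \<theta> `` {y}"
    using cong_sym cong_trans by blast
  then show "j x = j y"
    by (simp add: class_max_def)
qed

lemma j_idem: "x \<in> carrier Q \<Longrightarrow> j (j x) = j x"
  using j_eq_iff[of x "j x"] j_cong j_closed by simp

lemma j_mono:
  assumes "x \<in> carrier Q" "y \<in> carrier Q" "x \<sqsubseteq> y"
  shows "j x \<sqsubseteq> j y"
proof -
  have "(\<Squnion>((\<lambda>z. z) ` {x, y}), \<Squnion>(j ` {x, y})) \<in> \<theta>"
    by (rule cong_sup_image) (use assms j_cong in auto)
  moreover have "\<Squnion>{x, y} = y"
    using assms by (intro le_antisym sup_least sup_upper sup_closed) auto
  ultimately have "\<Squnion>(j ` {x, y}) \<sqsubseteq> j y"
    using j_greatest by simp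
  moreover have "j x \<sqsubseteq> \<Squnion>(j ` {x, y})"
    using assms j_closed by (intro sup_upper) auto
  ultimately show ?thesis
    using le_trans[of "j x" "\<Squnion>(j ` {x, y})" "j y"] assms j_closed by simp
qed

lemma R_simps [simp]:
  "carrier R = j ` carrier Q" "eq R = (=)" "le R = le Q" "mult R a b = j (a \<otimes> b)"
  by (simp_all add: quotient_quantale_def)

lemma R_carrier: "x \<in> carrier R \<longleftrightarrow> x \<in> carrier Q \<and> j x = x"
proof
  assume "x \<in> carrier R"
  then obtain y where "y \<in> carrier Q" "x = j y" by auto
  then show "x \<in> carrier Q \<and> j x = x" by (simp add: j_closed j_idem)
next
  assume "x \<in> carrier Q \<and> j x = x"
  then have "x = j x" "x \<in> carrier Q" by simp_all
  then show "x \<in> carrier R" by (simp only: R_simps(1)) (rule image_eqI)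
qed

lemma R_carrier_subset: "A \<subseteq> carrier R \<Longrightarrow> A \<subseteq> carrier Q"
  using R_carrier by blast

lemma R_partial_order: "partial_order R"
proof (unfold_locales, unfold R_simps(2,3))
  fix x y z
  have sub: "u \<in> carrier Q" if "u \<in> carrier R" for u
    using that by (simp only: R_carrier)
  show "x \<sqsubseteq> x" if "x \<in> carrier R"
    using that sub le_refl by blast
  show "x = y" if "x \<sqsubseteq> y" "y \<sqsubseteq> x" "x \<in> carrier R" "y \<in> carrier R"
    by (rule le_antisym[OF that(1,2) sub[OF that(3)] sub[OF that(4)]])
  show "x \<sqsubseteq> z" if "x \<sqsubseteq> y" "y \<sqsubseteq> z" "x \<in> carrier R" "y \<in> carrier R" "z \<in> carrier R"
    by (rule le_trans[OF that(1,2) sub[OF that(3)] sub[OF that(4)] sub[OF that(5)]])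
qed (simp_all del: R_simps(1))

lemma R_sup_least:
  assumes "A \<subseteq> carrier R"
  shows "least R (j (\<Squnion>A)) (Upper R A)"
proof -
  have A: "A \<subseteq> carrier Q" using assms by (rule R_carrier_subset)
  have c: "\<Squnion>A \<in> carrier Q" using A by simp
  show ?thesis
    unfolding least_def
  proof (intro conjI ballI)
    show "Upper R A \<subseteq> carrier R" by (auto simp: Upper_def)
    show "j (\<Squnion>A) \<in> Upper R A"
      using A c by (auto simp: Upper_def) (meson A c in_mono j_closed j_increasing le_trans sup_upper)
    fix u assume "u \<in> Upper R A"
    then have u: "u \<in> carrier Q" "j u = u" and "\<And>x. x \<in> A \<Longrightarrow> x \<sqsubseteq> u"
      using assms R_carrier by (auto simp: Upper_def simp del: R_simps(1))
    then have "\<Squnion>A \<sqsubseteq> u" using A by (intro sup_least) auto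
    then show "j (\<Squnion>A) \<sqsubseteq>\<^bsub>R\<^esub> u" using j_mono[OF c u(1)] u by simp
  qed
qed

lemma R_inf_greatest:
  assumes "A \<subseteq> carrier R"
  shows "greatest R (j (\<Sqinter>A)) (Lower R A)"
proof -
  have A: "A \<subseteq> carrier Q" using assms by (rule R_carrier_subset)
  have c: "\<Sqinter>A \<in> carrier Q" using A by simp
  show ?thesis
    unfolding greatest_def
  proof (intro conjI ballI)
    show "Lower R A \<subseteq> carrier R" by (auto simp: Lower_def)
    have "j (\<Sqinter>A) \<sqsubseteq> x" if "x \<in> A" for x
      using j_mono[OF c, of x] inf_lower[OF A that] assms A that R_carrier
      by (metis subsetD)
    then show "j (\<Sqinter>A) \<in> Lower R A"
      using c by (auto simp: Lower_def)
    fix u assume "u \<in> Lower R A"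
    then have u: "u \<in> carrier Q" "j u = u" and "\<And>x. x \<in> A \<Longrightarrow> u \<sqsubseteq> x"
      using assms R_carrier by (auto simp: Lower_def simp del: R_simps(1))
    then have "u \<sqsubseteq> \<Sqinter>A" using A by (intro inf_greatest) auto
    then show "u \<sqsubseteq>\<^bsub>R\<^esub> j (\<Sqinter>A)" using j_mono[OF u(1) c] u by simp
  qed
qed

lemma R_complete_lattice: "complete_lattice R"
  by (rule partial_order.complete_latticeI[OF R_partial_order])
    (use R_sup_least R_inf_greatest in blast)+

lemma R_sup:
  assumes "A \<subseteq> carrier R"
  shows "\<Squnion>\<^bsub>R\<^esub>A = j (\<Squnion>A)"
proof -
  interpret R: complete_lattice R by (rule R_complete_lattice)
  show ?thesis
    using R.least_unique[OF R.sup_lub[OF assms] R_sup_least[OF assms]] .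
qed

lemma j_sup:
  assumes "A \<subseteq> carrier Q"
  shows "j (\<Squnion>A) = j (\<Squnion>(j ` A))"
proof -
  have "(\<Squnion>((\<lambda>x. x) ` A), \<Squnion>(j ` A)) \<in> \<theta>"
    by (rule cong_sup_image) (use assms j_cong in auto)
  then show ?thesis
    using assms cong_carrier j_eq_iff by (metis image_ident)
qed

lemma j_mult_left:
  assumes "a \<in> carrier Q" "b \<in> carrier Q"
  shows "j (j a \<otimes> b) = j (a \<otimes> b)"
  using assms j_eq_iff j_cong cong_mult_right cong_sym cong_carrier by metis

lemma j_mult_right:
  assumes "a \<in> carrier Q" "b \<in> carrier Q"
  shows "j (a \<otimes> j b) = j (a \<otimes> b)"
  using assms j_eq_iff j_cong cong_mult_left cong_sym cong_carrier by metis

lemma R_quantale: "quantale R"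
proof -
  interpret R: complete_lattice R by (rule R_complete_lattice)
  show ?thesis
  proof
    fix a b assume "a \<in> carrier R" "b \<in> carrier R"
    then have a: "a \<in> carrier Q" and b: "b \<in> carrier Q" using R_carrier by blast+
    show "a \<otimes>\<^bsub>R\<^esub> b \<in> carrier R" using a b mult_closed by simp
    fix c assume "c \<in> carrier R"
    then have c: "c \<in> carrier Q" using R_carrier by blast
    show "a \<otimes>\<^bsub>R\<^esub> b \<otimes>\<^bsub>R\<^esub> c = a \<otimes>\<^bsub>R\<^esub> (b \<otimes>\<^bsub>R\<^esub> c)"
      using a b c by (simp add: j_mult_left j_mult_right mult_closed mult_assoc)
  next
    fix a A assume "a \<in> carrier R" and AR: "A \<subseteq> carrier R"
    then have a: "a \<in> carrier Q" and A: "A \<subseteq> carrier Q"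
      using R_carrier R_carrier_subset by blast+
    have "a \<otimes>\<^bsub>R\<^esub> \<Squnion>\<^bsub>R\<^esub>A = j (\<Squnion>((\<lambda>x. a \<otimes> x) ` A))"
      using a A by (simp add: R_sup[OF AR] j_mult_right mult_sup_right)
    also have "\<dots> = j (\<Squnion>(j ` (\<lambda>x. a \<otimes> x) ` A))"
      using a A mult_closed by (intro j_sup) auto
    also have "\<dots> = \<Squnion>\<^bsub>R\<^esub>((\<lambda>x. a \<otimes>\<^bsub>R\<^esub> x) ` A)"
      using a A mult_closed by (subst R_sup) (auto simp: image_image)
    finally show "a \<otimes>\<^bsub>R\<^esub> \<Squnion>\<^bsub>R\<^esub>A = \<Squnion>\<^bsub>R\<^esub>((\<lambda>x. a \<otimes>\<^bsub>R\<^esub> x) ` A)" .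
    have "\<Squnion>\<^bsub>R\<^esub>A \<otimes>\<^bsub>R\<^esub> a = j (\<Squnion>((\<lambda>x. x \<otimes> a) ` A))"
      using a A by (simp add: R_sup[OF AR] j_mult_left mult_sup_left)
    also have "\<dots> = j (\<Squnion>(j ` (\<lambda>x. x \<otimes> a) ` A))"
      using a A mult_closed by (intro j_sup) auto
    also have "\<dots> = \<Squnion>\<^bsub>R\<^esub>((\<lambda>x. x \<otimes>\<^bsub>R\<^esub> a) ` A)"
      using a A mult_closed by (subst R_sup) (auto simp: image_image)
    finally show "\<Squnion>\<^bsub>R\<^esub>A \<otimes>\<^bsub>R\<^esub> a = \<Squnion>\<^bsub>R\<^esub>((\<lambda>x. x \<otimes>\<^bsub>R\<^esub> a) ` A)" .
  qed
qed

lemma j_hom: "j \<in> quantale_hom Q R"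
  unfolding quantale_hom_def sup_pres_def
proof (intro CollectI conjI ballI allI impI)
  show "complete_lattice Q" by unfold_locales
  show "complete_lattice R" by (rule R_complete_lattice)
  show "j \<in> carrier Q \<rightarrow> carrier R" by simp
  fix A assume A: "A \<subseteq> carrier Q"
  then have "j ` A \<subseteq> carrier R" by auto
  then show "j (\<Squnion>A) = \<Squnion>\<^bsub>R\<^esub>(j ` A)"
    using j_sup[OF A] by (simp add: R_sup)
next
  fix a b assume "a \<in> carrier Q" "b \<in> carrier Q"
  then show "j (a \<otimes> b) = j a \<otimes>\<^bsub>R\<^esub> j b"
    by (simp add: j_mult_left j_mult_right j_closed)
qed

end

context quantale
begin

theorem simple_quantale_iff_congruences:
  "simple_quantale Q \<longleftrightarrow>
    \<top> \<otimes> \<top> \<noteq> \<bottom> \<and>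
    {\<theta>. quantale_congruence Q \<theta>} = {Id_on (carrier Q), carrier Q \<times> carrier Q}"
proof (intro iffI conjI)
  assume simple: "simple_quantale Q"
  then show "\<top> \<otimes> \<top> \<noteq> \<bottom>" by (simp add: simple_quantale_def)
  have "\<theta> = Id_on (carrier Q) \<or> \<theta> = carrier Q \<times> carrier Q" if "quantale_congruence Q \<theta>" for \<theta>
  proof -
    interpret quantale_with_congruence Q \<theta> by unfold_locales (rule that)
    have "j \<in> quantale_iso Q R \<or> (\<exists>c. carrier R = {c})"
      using simple R_quantale j_hom unfolding simple_quantale_def by (metis R_simps(1))
    then show ?thesis
    proof
      assume "j \<in> quantale_iso Q R"
      then have "inj_on j (carrier Q)" by (simp add: quantale_iso_def bij_betw_def)
      then have "\<theta> = Id_on (carrier Q)"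
        using j_eq_iff cong_carrier cong_refl by (auto simp: inj_on_def Id_on_def) metis
      then show ?thesis ..
    next
      assume "\<exists>c. carrier R = {c}"
      then obtain c where "j ` carrier Q = {c}" by auto
      then have j_const: "j x = j y" if "x \<in> carrier Q" "y \<in> carrier Q" for x y
        using that by (metis imageI singletonD)
      have "(x, y) \<in> \<theta>" if "x \<in> carrier Q" "y \<in> carrier Q" for x y
        using j_eq_iff[OF that] j_const[OF that] by (rule iffD1)
      then have "carrier Q \<times> carrier Q \<subseteq> \<theta>" by auto
      then have "\<theta> = carrier Q \<times> carrier Q" using cong_subset by (rule equalityI[rotated])
      then show ?thesis ..
    qed
  qed
  then show "{\<theta>. quantale_congruence Q \<theta>} = {Id_on (carrier Q), carrier Q \<times> carrier Q}"
    using quantale_congruence_Id quantale_congruence_total by auto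
next
  assume *: "\<top> \<otimes> \<top> \<noteq> \<bottom> \<and>
    {\<theta>. quantale_congruence Q \<theta>} = {Id_on (carrier Q), carrier Q \<times> carrier Q}"
  show "simple_quantale Q"
    unfolding simple_quantale_def
  proof (intro conjI allI impI)
    show "\<top> \<otimes> \<top> \<noteq> \<bottom>" using * by simp
    fix R :: "'a quantale" and f
    assume f: "f \<in> quantale_hom Q R" and surj: "f ` carrier Q = carrier R"
    consider "hom_kernel Q f = Id_on (carrier Q)" | "hom_kernel Q f = carrier Q \<times> carrier Q"
      using * quantale_congruence_hom_kernel[OF f] by auto
    then show "f \<in> quantale_iso Q R \<or> (\<exists>c. carrier R = {c})"
    proof cases
      case 1
      then have "inj_on f (carrier Q)"
        unfolding hom_kernel_def inj_on_def Id_on_def by blast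
      then show ?thesis using f surj by (simp add: quantale_iso_def bij_betw_def)
    next
      case 2
      have "f ` carrier Q = {f \<top>}"
        by (rule hom_kernel_total[OF 2])
      then show ?thesis using surj by simp
    qed
  qed
qed

theorem simple_quantale_any_type:
  fixes R :: "('b, 'n) quantale_scheme"
  assumes "simple_quantale Q" "f \<in> quantale_hom Q R" "f ` carrier Q = carrier R"
  shows "f \<in> quantale_iso Q R \<or> (\<exists>c. carrier R = {c})"
proof -
  consider "hom_kernel Q f = Id_on (carrier Q)" | "hom_kernel Q f = carrier Q \<times> carrier Q"
    using assms(1) quantale_congruence_hom_kernel[OF assms(2)]
    by (auto simp: simple_quantale_iff_congruences)
  then show ?thesis
  proof cases
    case 1
    then have "inj_on f (carrier Q)"
      unfolding hom_kernel_def inj_on_def Id_on_def by blast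
    then show ?thesis using assms by (simp add: quantale_iso_def bij_betw_def)
  next
    case 2
    have "f ` carrier Q = {f \<top>}"
      by (rule hom_kernel_total[OF 2])
    then show ?thesis using assms(3) by simp
  qed
qed

end

end

theory Submission
  imports Defs
begin

text \<open>
  The link between the three conditions is the set of \<^emph>\<open>polars\<close> \<open>r \<rightarrow> \<bottom> \<leftarrow> l\<close> with \<open>l\<close> left-sided and
  \<open>r\<close> right-sided. The point is that \<open>l \<otimes> a \<otimes> r\<close> is always two-sided, so in a factor it can only be
  \<open>\<bottom>\<close> or \<open>\<top>\<close>. The test \<open>l \<otimes> a \<otimes> r\<close> then carries a single bit of information, namely whether \<open>a\<close>
  lies below the polar \<open>r \<rightarrow> \<bottom> \<leftarrow> l\<close>, and strict faithfulness of a factor says precisely that the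
  polars are separating (\<open>strictly_faithful_iff_separating_polars\<close>).

  Simplicity enters through the congruences of the form ``\<open>a\<close> and \<open>b\<close> lie below the same elements of
  \<open>C\<close>'', where \<open>C\<close> is closed under residuation (\<open>quantale_congruence_same_bounds\<close>). Taking
  for \<open>C\<close> the elements above a given two-sided element shows that a simple quantale is a factor; taking
  for \<open>C\<close> the polars shows that it is strictly faithful. Conversely, a congruence that identifies two
  distinct elements of a strictly faithful factor also identifies \<open>l \<otimes> a \<otimes> r\<close> with
  \<open>l \<otimes> b \<otimes> r\<close>, that is, \<open>\<bottom>\<close> with \<open>\<top>\<close>, and so identifies everything.

  For the third condition, the polars other than \<open>\<top>\<close> form a cyclic set in a strictly faithful factor.
  In the other direction, a two-sided element below one element of a cyclic set is below all of
  them, so separation leaves only \<open>\<bottom>\<close> and \<open>\<top>\<close> as two-sided elements. Since \<open>\<top> \<rightarrow> q \<leftarrow> \<top>\<close> is then a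
  two-sided member of the cyclic set, \<open>\<bottom>\<close> itself belongs to it. Hence all its members are of the form
  \<open>c \<rightarrow> \<bottom> \<leftarrow> d\<close>, and these are polars.
\<close>

section \<open>Two-sided residuals and polars\<close>

context quantale
begin

lemma le_bottom_iff:
  assumes "x \<in> carrier Q"
  shows "x \<sqsubseteq> \<bottom> \<longleftrightarrow> x = \<bottom>"
  using assms by (meson bottom_closed bottom_lower le_antisym le_refl)

lemma top_le_iff:
  assumes "x \<in> carrier Q"
  shows "\<top> \<sqsubseteq> x \<longleftrightarrow> x = \<top>"
  using assms by (meson top_closed top_higher le_antisym le_refl)

lemma sup_le_iff:
  assumes "A \<subseteq> carrier Q" "x \<in> carrier Q"
  shows "\<Squnion>A \<sqsubseteq> x \<longleftrightarrow> (\<forall>a\<in>A. a \<sqsubseteq> x)"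
  using assms by (meson sup_least sup_upper le_trans sup_closed subsetD)

lemma pair_sup_le_iff:
  assumes "a \<in> carrier Q" "b \<in> carrier Q" "x \<in> carrier Q"
  shows "\<Squnion>{a, b} \<sqsubseteq> x \<longleftrightarrow> a \<sqsubseteq> x \<and> b \<sqsubseteq> x"
  using assms sup_le_iff[of "{a, b}" x] by auto

lemma not_le_imp_neq_pair_sup:
  assumes "a \<in> carrier Q" "b \<in> carrier Q" "\<not> b \<sqsubseteq> a"
  shows "a \<noteq> \<Squnion>{a, b}"
  using assms pair_sup_le_iff[of a b a] by auto

lemma eqI_lower:
  assumes "x \<in> carrier Q" "y \<in> carrier Q"
    and "\<And>z. z \<in> carrier Q \<Longrightarrow> z \<sqsubseteq> x \<longleftrightarrow> z \<sqsubseteq> y"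
  shows "x = y"
  using assms le_refl le_antisym by metis

lemma mult_bottom_right: "a \<in> carrier Q \<Longrightarrow> a \<otimes> \<bottom> = \<bottom>"
  using le_res_from_iff[of a \<bottom> \<bottom>] by (simp add: le_bottom_iff mult_closed)

lemma mult_bottom_left: "a \<in> carrier Q \<Longrightarrow> \<bottom> \<otimes> a = \<bottom>"
  using le_res_to_iff[of \<bottom> a \<bottom>] by (simp add: le_bottom_iff mult_closed)

text \<open>In arrow notation, \<open>two_res a p b\<close> is \<open>a \<rightarrow> p \<leftarrow> b\<close>.\<close>

abbreviation "two_res a p b \<equiv> res_from Q (res_to Q a p) b"

lemma le_two_res_iff:
  assumes "x \<in> carrier Q" "a \<in> carrier Q" "p \<in> carrier Q" "b \<in> carrier Q"
  shows "x \<sqsubseteq> two_res a p b \<longleftrightarrow> b \<otimes> x \<otimes> a \<sqsubseteq> p"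
  using assms by (simp add: le_res_from_iff le_res_to_iff mult_closed)

lemma le_two_res_bottom_iff:
  assumes "x \<in> carrier Q" "a \<in> carrier Q" "b \<in> carrier Q"
  shows "x \<sqsubseteq> two_res a \<bottom> b \<longleftrightarrow> b \<otimes> x \<otimes> a = \<bottom>"
  using assms by (simp add: le_two_res_iff le_bottom_iff mult_closed)

lemma two_res_two_res:
  assumes "a \<in> carrier Q" "b \<in> carrier Q" "c \<in> carrier Q" "d \<in> carrier Q" "p \<in> carrier Q"
  shows "two_res a (two_res c p d) b = two_res (a \<otimes> c) p (d \<otimes> b)"
  using assms by (intro eqI_lower) (simp_all add: le_two_res_iff mult_closed mult_assoc)

text \<open>
  A polar is the largest element annihilated by one of the tests \<open>x \<mapsto> l \<otimes> x \<otimes> r\<close> of strict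
  faithfulness.
\<close>

definition polars :: "'a set"
  where "polars = {two_res r \<bottom> l | l r. l \<in> left_sided Q \<and> r \<in> right_sided Q}"

lemma polars_closed: "polars \<subseteq> carrier Q"
  by (auto simp: polars_def)

lemma polarI: "\<lbrakk>l \<in> left_sided Q; r \<in> right_sided Q\<rbrakk> \<Longrightarrow> two_res r \<bottom> l \<in> polars"
  unfolding polars_def by blast

lemma polarE:
  assumes "x \<in> polars"
  obtains l r where "l \<in> left_sided Q" "r \<in> right_sided Q" "l \<in> carrier Q" "r \<in> carrier Q"
    "x = two_res r \<bottom> l"
  using assms unfolding polars_def left_sided_def right_sided_def by blast

lemma left_sided_mult: "\<lbrakk>l \<in> left_sided Q; a \<in> carrier Q\<rbrakk> \<Longrightarrow> l \<otimes> a \<in> left_sided Q"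
  using mult_mono_left[of a "\<top> \<otimes> l" l]
  by (simp add: left_sided_def mult_closed mult_assoc)

lemma right_sided_mult: "\<lbrakk>r \<in> right_sided Q; a \<in> carrier Q\<rbrakk> \<Longrightarrow> a \<otimes> r \<in> right_sided Q"
  using mult_mono_right[of a "r \<otimes> \<top>" r]
  by (simp add: right_sided_def mult_closed mult_assoc)

lemma top_left_sided: "\<top> \<in> left_sided Q"
  by (simp add: left_sided_def mult_closed)

lemma top_right_sided: "\<top> \<in> right_sided Q"
  by (simp add: right_sided_def mult_closed)

lemma top_mult_left_sided: "a \<in> carrier Q \<Longrightarrow> \<top> \<otimes> a \<in> left_sided Q"
  by (rule left_sided_mult[OF top_left_sided])

lemma mult_top_right_sided: "a \<in> carrier Q \<Longrightarrow> a \<otimes> \<top> \<in> right_sided Q"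
  by (rule right_sided_mult[OF top_right_sided])

lemma bottom_two_sided: "\<bottom> \<in> two_sided Q"
  by (simp add: two_sided_def left_sided_def right_sided_def mult_bottom_left mult_bottom_right)

lemma top_two_sided: "\<top> \<in> two_sided Q"
  by (simp add: two_sided_def top_left_sided top_right_sided)

lemma two_sided_mult_left:
  assumes "t \<in> two_sided Q" "a \<in> carrier Q"
  shows "a \<otimes> t \<sqsubseteq> t"
  using assms mult_mono_left[of t a \<top>] le_trans[of "a \<otimes> t" "\<top> \<otimes> t" t]
  by (simp add: two_sided_def left_sided_def mult_closed)

lemma two_sided_mult_right:
  assumes "t \<in> two_sided Q" "a \<in> carrier Q"
  shows "t \<otimes> a \<sqsubseteq> t"
  using assms mult_mono_right[of t a \<top>] le_trans[of "t \<otimes> a" "t \<otimes> \<top>" t]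
  by (simp add: two_sided_def right_sided_def mult_closed)

text \<open>
  The factor \<open>l\<close> absorbs \<open>\<top>\<close> from the left and \<open>r\<close> absorbs it from the right, whatever stands between
  them. All of the values tested by strict faithfulness are therefore \<open>\<bottom>\<close> or \<open>\<top>\<close> in a factor.
\<close>

lemma two_sided_sandwich:
  assumes "l \<in> left_sided Q" "a \<in> carrier Q" "r \<in> right_sided Q"
  shows "l \<otimes> a \<otimes> r \<in> two_sided Q"
proof -
  have "l \<in> carrier Q" "r \<in> carrier Q"
    using assms by (simp_all add: left_sided_def right_sided_def)
  then show ?thesis
    using assms left_sided_mult[of l "a \<otimes> r"] right_sided_mult[of r "l \<otimes> a"]
    by (simp add: two_sided_def mult_closed mult_assoc)
qed


section \<open>Factors\<close>

lemma factor_sandwich_cases: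
  assumes "factor Q" "l \<in> left_sided Q" "a \<in> carrier Q" "r \<in> right_sided Q"
  shows "l \<otimes> a \<otimes> r = \<bottom> \<or> l \<otimes> a \<otimes> r = \<top>"
  using assms two_sided_sandwich[of l a r] by (auto simp: factor_def)

lemma factor_top_idem:
  assumes "factor Q" "\<top> \<otimes> \<top> \<noteq> \<bottom>"
  shows "\<top> \<otimes> \<top> = \<top>"
proof -
  have "\<top> \<otimes> \<top> \<in> two_sided Q"
    by (simp add: two_sided_def left_sided_mult top_left_sided right_sided_mult top_right_sided)
  then show ?thesis
    using assms by (auto simp: factor_def)
qed

lemma two_sided_two_res_top:
  assumes "\<top> \<otimes> \<top> = \<top>" "q \<in> carrier Q"
  shows "two_res \<top> q \<top> \<in> two_sided Q"
proof -
  let ?m = "two_res \<top> q \<top>"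
  have top_absorb: "\<top> \<otimes> (\<top> \<otimes> x) = \<top> \<otimes> x" if "x \<in> carrier Q" for x
    using that assms(1) by (simp flip: mult_assoc)
  have "\<top> \<otimes> (?m \<otimes> \<top>) \<sqsubseteq> q"
    using assms le_two_res_iff[of ?m \<top> q \<top>] by (simp add: mult_assoc)
  then show ?thesis
    using assms
    by (simp add: two_sided_def left_sided_def right_sided_def le_two_res_iff mult_closed
        mult_assoc top_absorb)
qed

text \<open>
  The largest element killed by \<open>\<top>\<close> on both sides is two-sided, and it is not \<open>\<top>\<close>.
\<close>

lemma factor_top_sandwich_eq_bottom_iff:
  assumes "factor Q" "\<top> \<otimes> \<top> \<noteq> \<bottom>" "y \<in> carrier Q"
  shows "\<top> \<otimes> y \<otimes> \<top> = \<bottom> \<longleftrightarrow> y = \<bottom>"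
proof
  let ?t = "two_res \<top> \<bottom> \<top>"
  have idem: "\<top> \<otimes> \<top> = \<top>"
    using assms by (intro factor_top_idem)
  have "?t \<in> two_sided Q"
    using idem by (intro two_sided_two_res_top) auto
  moreover have "?t \<noteq> \<top>"
    using assms idem top_le_iff[of ?t] by (simp add: le_two_res_bottom_iff)
  ultimately have t: "?t = \<bottom>"
    using assms by (auto simp: factor_def)
  assume "\<top> \<otimes> y \<otimes> \<top> = \<bottom>"
  then have "y \<sqsubseteq> ?t"
    using assms by (subst le_two_res_bottom_iff) auto
  then show "y = \<bottom>"
    using assms by (simp add: t le_bottom_iff)
qed (simp add: mult_bottom_left mult_bottom_right)

text \<open>
  Multiplying by \<open>\<top>\<close> on the outside makes \<open>b\<close> left-sided and \<open>a\<close> right-sided, and in a factor it does not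
  change which products \<open>b \<otimes> z \<otimes> a\<close> vanish. So every residual of \<open>\<bottom>\<close> is a polar.
\<close>

lemma factor_two_res_bottom_eq_polar:
  assumes "factor Q" "\<top> \<otimes> \<top> \<noteq> \<bottom>" "a \<in> carrier Q" "b \<in> carrier Q"
  shows "two_res a \<bottom> b = two_res (a \<otimes> \<top>) \<bottom> (\<top> \<otimes> b)"
proof (rule eqI_lower)
  fix z assume z: "z \<in> carrier Q"
  then have "\<top> \<otimes> b \<otimes> z \<otimes> (a \<otimes> \<top>) = \<top> \<otimes> (b \<otimes> z \<otimes> a) \<otimes> \<top>"
    using assms by (simp add: mult_assoc mult_closed)
  then show "z \<sqsubseteq> two_res a \<bottom> b \<longleftrightarrow> z \<sqsubseteq> two_res (a \<otimes> \<top>) \<bottom> (\<top> \<otimes> b)"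
    using z assms factor_top_sandwich_eq_bottom_iff[of "b \<otimes> z \<otimes> a"]
    by (simp add: le_two_res_bottom_iff mult_closed)
qed auto

text \<open>
  Both properties ask the polars to tell elements apart: two distinct values of \<open>l \<otimes> x \<otimes> r\<close> in a
  factor are \<open>\<bottom>\<close> and \<open>\<top>\<close>. Strict faithfulness compares elements for equality, separation for the
  order; the passage between the two is the equivalence of \<open>b \<sqsubseteq> a\<close> with \<open>a = \<Squnion>{a, b}\<close>.
\<close>

lemma strictly_faithful_iff_separating_polars:
  assumes factor: "factor Q"
  shows "strictly_faithful Q \<longleftrightarrow> separating Q polars"
proof
  assume sf: "strictly_faithful Q"
  show "separating Q polars"
    unfolding separating_def
  proof (intro conjI ballI impI)
    show "polars \<subseteq> carrier Q" by (rule polars_closed)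
    fix a b assume a: "a \<in> carrier Q" and b: "b \<in> carrier Q" and nle: "\<not> b \<sqsubseteq> a"
    let ?c = "\<Squnion>{a, b}"
    have c: "?c \<in> carrier Q" using a b by simp
    note c_le = pair_sup_le_iff[OF a b]
    have "a \<noteq> ?c"
      by (rule not_le_imp_neq_pair_sup[OF a b nle])
    then obtain l r where l: "l \<in> left_sided Q" and r: "r \<in> right_sided Q"
      and neq: "l \<otimes> a \<otimes> r \<noteq> l \<otimes> ?c \<otimes> r"
      using sf a c unfolding strictly_faithful_def by metis
    then have lr: "l \<in> carrier Q" "r \<in> carrier Q"
      by (simp_all add: left_sided_def right_sided_def)
    let ?p = "two_res r \<bottom> l"
    \<comment> \<open>The value at \<open>\<Squnion>{a, b}\<close> cannot be \<open>\<bottom>\<close>, since the value at \<open>a\<close> is below it and different.\<close>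
    have "\<not> ?c \<sqsubseteq> ?p"
    proof
      assume c_below: "?c \<sqsubseteq> ?p"
      then have "a \<sqsubseteq> ?p"
        using c_le[of ?p] by simp
      then show False
        using neq c_below a c lr by (simp add: le_two_res_bottom_iff)
    qed
    moreover from this have "l \<otimes> a \<otimes> r = \<bottom>"
      using factor_sandwich_cases[OF factor l a r] factor_sandwich_cases[OF factor l c r]
        neq a c lr by (auto simp: le_two_res_bottom_iff)
    then have "a \<sqsubseteq> ?p"
      using a lr by (simp add: le_two_res_bottom_iff)
    moreover have "?p \<in> polars"
      using l r by (rule polarI)
    ultimately show "\<exists>p\<in>polars. a \<sqsubseteq> p \<and> \<not> b \<sqsubseteq> p"
      using c_le[of ?p] by auto
  qed
next
  assume sep: "separating Q polars"
  have le: "b \<sqsubseteq> a" if a: "a \<in> carrier Q" and b: "b \<in> carrier Q"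
    and eq: "\<And>l r. \<lbrakk>l \<in> left_sided Q; r \<in> right_sided Q\<rbrakk> \<Longrightarrow> l \<otimes> a \<otimes> r = l \<otimes> b \<otimes> r" for a b
  proof (rule ccontr)
    assume "\<not> b \<sqsubseteq> a"
    then obtain p where p: "p \<in> polars" and ap: "a \<sqsubseteq> p" and bp: "\<not> b \<sqsubseteq> p"
      using sep a b unfolding separating_def by blast
    obtain l r where l: "l \<in> left_sided Q" "l \<in> carrier Q" and r: "r \<in> right_sided Q" "r \<in> carrier Q"
      and "p = two_res r \<bottom> l"
      using p by (rule polarE)
    then show False
      using ap bp a b eq[OF l(1) r(1)] by (simp add: le_two_res_bottom_iff)
  qed
  show "strictly_faithful Q"
    unfolding strictly_faithful_def
  proof (intro ballI impI)
    fix a b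
    assume "a \<in> carrier Q" "b \<in> carrier Q"
      and "\<forall>l\<in>left_sided Q. \<forall>r\<in>right_sided Q. l \<otimes> a \<otimes> r = l \<otimes> b \<otimes> r"
    then show "a = b"
      using le[of a b] le[of b a] by (simp add: le_antisym)
  qed
qed

lemma strictly_faithful_factor_top_mult_top:
  assumes "strictly_faithful Q" "factor Q"
  shows "\<top> \<otimes> \<top> \<noteq> \<bottom>"
proof
  assume nil: "\<top> \<otimes> \<top> = \<bottom>"
  have "x \<otimes> y = \<bottom>" if "x \<in> carrier Q" "y \<in> carrier Q" for x y
  proof -
    have "x \<otimes> y \<sqsubseteq> x \<otimes> \<top>" "x \<otimes> \<top> \<sqsubseteq> \<top> \<otimes> \<top>"
      using that by (simp_all add: mult_mono_left mult_mono_right)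
    then have "x \<otimes> y \<sqsubseteq> \<top> \<otimes> \<top>"
      by (rule le_trans) (simp_all add: that mult_closed)
    then show ?thesis
      using that by (simp add: nil le_bottom_iff mult_closed)
  qed
  then have "l \<otimes> \<bottom> \<otimes> r = l \<otimes> \<top> \<otimes> r" if "l \<in> left_sided Q" "r \<in> right_sided Q" for l r
    using that by (simp add: left_sided_def right_sided_def mult_closed)
  then show False
    using assms unfolding strictly_faithful_def factor_def by auto
qed


section \<open>Simple quantales and strictly faithful factors\<close>

definition same_bounds :: "'a set \<Rightarrow> ('a \<times> 'a) set"
  where "same_bounds C = {(a, b). a \<in> carrier Q \<and> b \<in> carrier Q \<and> (\<forall>x\<in>C. a \<sqsubseteq> x \<longleftrightarrow> b \<sqsubseteq> x)}"

text \<open>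
  Compatibility with joins and multiplication comes from the adjunctions \<open>\<Squnion>A \<sqsubseteq> x \<longleftrightarrow> (\<forall>a\<in>A. a \<sqsubseteq> x)\<close>,
  \<open>a \<otimes> c \<sqsubseteq> x \<longleftrightarrow> a \<sqsubseteq> c \<rightarrow> x\<close> and \<open>c \<otimes> a \<sqsubseteq> x \<longleftrightarrow> a \<sqsubseteq> x \<leftarrow> c\<close>, which move every test against \<open>C\<close> back to the
  original pair of elements.
\<close>

lemma quantale_congruence_same_bounds:
  assumes C: "C \<subseteq> carrier Q"
    and res: "\<And>x c. \<lbrakk>x \<in> C; c \<in> carrier Q\<rbrakk> \<Longrightarrow> res_to Q c x \<in> C"
      "\<And>x c. \<lbrakk>x \<in> C; c \<in> carrier Q\<rbrakk> \<Longrightarrow> res_from Q x c \<in> C"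
  shows "quantale_congruence Q (same_bounds C)"
  unfolding quantale_congruence_def
proof (intro conjI allI impI)
  show "same_bounds C \<subseteq> carrier Q \<times> carrier Q"
    by (auto simp: same_bounds_def)
  show "equiv (carrier Q) (same_bounds C)"
    by (auto simp: same_bounds_def equiv_def refl_on_def sym_def trans_def)
  have "(c \<otimes> a, c \<otimes> b) \<in> same_bounds C \<and> (a \<otimes> c, b \<otimes> c) \<in> same_bounds C"
    if ab: "(a, b) \<in> same_bounds C" and c: "c \<in> carrier Q" for a b c
  proof -
    have a: "a \<in> carrier Q" and b: "b \<in> carrier Q"
      and iff: "\<And>x. x \<in> C \<Longrightarrow> a \<sqsubseteq> x \<longleftrightarrow> b \<sqsubseteq> x"
      using ab by (simp_all add: same_bounds_def)
    have "c \<otimes> a \<sqsubseteq> x \<longleftrightarrow> c \<otimes> b \<sqsubseteq> x" "a \<otimes> c \<sqsubseteq> x \<longleftrightarrow> b \<otimes> c \<sqsubseteq> x" if x: "x \<in> C" for x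
    proof -
      have "x \<in> carrier Q" using x C by (rule subsetD[rotated])
      then show "c \<otimes> a \<sqsubseteq> x \<longleftrightarrow> c \<otimes> b \<sqsubseteq> x" "a \<otimes> c \<sqsubseteq> x \<longleftrightarrow> b \<otimes> c \<sqsubseteq> x"
        using iff[OF res(1)[OF x c]] iff[OF res(2)[OF x c]] a b c
        by (simp_all add: le_res_to_iff le_res_from_iff)
    qed
    then show ?thesis
      using a b c by (simp add: same_bounds_def mult_closed)
  qed
  then show "\<forall>(a, b)\<in>same_bounds C. \<forall>c\<in>carrier Q.
      (c \<otimes> a, c \<otimes> b) \<in> same_bounds C \<and> (a \<otimes> c, b \<otimes> c) \<in> same_bounds C"
    by blast
  fix S assume S: "S \<subseteq> same_bounds C"
  then have sub: "fst ` S \<subseteq> carrier Q" "snd ` S \<subseteq> carrier Q"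
    by (auto simp: same_bounds_def)
  have "\<Squnion>(fst ` S) \<sqsubseteq> x \<longleftrightarrow> \<Squnion>(snd ` S) \<sqsubseteq> x" if x: "x \<in> C" for x
  proof -
    have "x \<in> carrier Q" using x C by (rule subsetD[rotated])
    moreover have "fst s \<sqsubseteq> x \<longleftrightarrow> snd s \<sqsubseteq> x" if "s \<in> S" for s
      using subsetD[OF S that] x by (simp add: same_bounds_def case_prod_beta)
    ultimately show ?thesis
      by (simp add: sup_le_iff sub)
  qed
  then show "(\<Squnion>(fst ` S), \<Squnion>(snd ` S)) \<in> same_bounds C"
    using sub by (simp add: same_bounds_def)
qed

text \<open>
  The congruence of common bounds in \<open>C\<close> keeps \<open>p\<close> and \<open>\<top>\<close> apart, because \<open>p\<close> itself is a bound of
  only one of them. By simplicity it is then the identity, so elements of \<open>C\<close> distinguish \<open>a\<close> from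
  \<open>\<Squnion>{a, b}\<close> unless \<open>b \<sqsubseteq> a\<close>.
\<close>

lemma simple_quantale_separating:
  assumes simple: "simple_quantale Q"
    and C: "C \<subseteq> carrier Q"
    and res: "\<And>x c. \<lbrakk>x \<in> C; c \<in> carrier Q\<rbrakk> \<Longrightarrow> res_to Q c x \<in> C"
      "\<And>x c. \<lbrakk>x \<in> C; c \<in> carrier Q\<rbrakk> \<Longrightarrow> res_from Q x c \<in> C"
    and p: "p \<in> C" "p \<noteq> \<top>"
  shows "separating Q C"
  unfolding separating_def
proof (intro conjI ballI impI C)
  have "quantale_congruence Q (same_bounds C)"
    by (rule quantale_congruence_same_bounds[OF C res])
  then have "same_bounds C = Id_on (carrier Q) \<or> same_bounds C = carrier Q \<times> carrier Q"
    using simple unfolding simple_quantale_iff_congruences by blast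
  moreover have pc: "p \<in> carrier Q"
    using p(1) C by (rule subsetD[rotated])
  then have "(p, \<top>) \<notin> same_bounds C"
    using p by (auto simp: same_bounds_def top_le_iff)
  ultimately have Id: "same_bounds C = Id_on (carrier Q)"
    using pc by auto
  fix a b assume a: "a \<in> carrier Q" and b: "b \<in> carrier Q" and nle: "\<not> b \<sqsubseteq> a"
  let ?c = "\<Squnion>{a, b}"
  have c: "?c \<in> carrier Q" using a b by simp
  have "(a, ?c) \<notin> same_bounds C"
    using not_le_imp_neq_pair_sup[OF a b nle] by (simp add: Id Id_on_iff)
  then obtain x where x: "x \<in> C" "(a \<sqsubseteq> x) \<noteq> (?c \<sqsubseteq> x)"
    using a c by (auto simp: same_bounds_def)
  moreover have "x \<in> carrier Q" using x(1) C by (rule subsetD[rotated])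
  ultimately show "\<exists>p\<in>C. a \<sqsubseteq> p \<and> \<not> b \<sqsubseteq> p"
    using pair_sup_le_iff[OF a b] by auto
qed

text \<open>
  The elements above a two-sided \<open>t\<close> are closed under residuation, since multiples of \<open>t\<close> stay below
  \<open>t\<close>. They cannot tell \<open>\<bottom>\<close> from \<open>t\<close>, so they are separating only for \<open>t = \<bottom>\<close>.
\<close>

theorem simple_quantale_imp_factor:
  assumes "simple_quantale Q"
  shows "factor Q"
proof -
  have nonzero: "\<top> \<otimes> \<top> \<noteq> \<bottom>"
    using assms by (simp add: simple_quantale_def)
  then have "\<bottom> \<noteq> \<top>"
    using mult_bottom_left[OF bottom_closed] by auto
  moreover have "t = \<bottom>" if t: "t \<in> two_sided Q" and "t \<noteq> \<top>" for t
  proof (rule ccontr)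
    assume "t \<noteq> \<bottom>"
    have tc: "t \<in> carrier Q"
      using t by (simp add: two_sided_def left_sided_def)
    let ?C = "{x \<in> carrier Q. t \<sqsubseteq> x}"
    have "separating Q ?C"
    proof (rule simple_quantale_separating[OF assms])
      show "res_to Q c x \<in> ?C" "res_from Q x c \<in> ?C" if "x \<in> ?C" "c \<in> carrier Q" for x c
        using that tc two_sided_mult_right[OF t that(2)] two_sided_mult_left[OF t that(2)]
          le_trans[of "t \<otimes> c" t x] le_trans[of "c \<otimes> t" t x]
        by (simp_all add: le_res_to_iff le_res_from_iff mult_closed)
      show "t \<in> ?C" "t \<noteq> \<top>" "?C \<subseteq> carrier Q"
        using tc \<open>t \<noteq> \<top>\<close> by auto
    qed
    moreover have "\<not> t \<sqsubseteq> \<bottom>"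
      using \<open>t \<noteq> \<bottom>\<close> by (simp add: le_bottom_iff[OF tc])
    ultimately show False
      using tc bottom_closed unfolding separating_def by blast
  qed
  ultimately show ?thesis
    using bottom_two_sided top_two_sided unfolding factor_def by blast
qed

theorem simple_quantale_imp_strictly_faithful:
  assumes simple: "simple_quantale Q"
  shows "strictly_faithful Q"
proof -
  have factor: "factor Q"
    by (rule simple_quantale_imp_factor[OF simple])
  have nonzero: "\<top> \<otimes> \<top> \<noteq> \<bottom>"
    using simple by (simp add: simple_quantale_def)
  have "separating Q polars"
  proof (rule simple_quantale_separating[OF simple])
    show "polars \<subseteq> carrier Q" by (rule polars_closed)
    fix x c assume "x \<in> polars" and c: "c \<in> carrier Q"
    obtain l r where l: "l \<in> left_sided Q" "l \<in> carrier Q"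
      and r: "r \<in> right_sided Q" "r \<in> carrier Q" and x: "x = two_res r \<bottom> l"
      using \<open>x \<in> polars\<close> by (rule polarE)
    have "res_to Q c x = two_res (c \<otimes> r) \<bottom> l"
      unfolding x using l r c
      by (intro eqI_lower) (simp_all add: le_res_to_iff le_res_from_iff mult_closed mult_assoc)
    then show "res_to Q c x \<in> polars"
      using polarI[OF l(1) right_sided_mult[OF r(1) c]] by simp
    have "res_from Q x c = two_res r \<bottom> (l \<otimes> c)"
      unfolding x using l r c
      by (intro eqI_lower) (simp_all add: le_res_to_iff le_res_from_iff mult_closed mult_assoc)
    then show "res_from Q x c \<in> polars"
      using polarI[OF left_sided_mult[OF l(1) c] r(1)] by simp
  next
    show "two_res \<top> \<bottom> \<top> \<in> polars"
      by (rule polarI[OF top_left_sided top_right_sided])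
    show "two_res \<top> \<bottom> \<top> \<noteq> \<top>"
      using nonzero factor_top_idem[OF factor nonzero] top_le_iff[of "two_res \<top> \<bottom> \<top>"]
      by (simp add: le_two_res_bottom_iff)
  qed
  then show ?thesis
    by (simp add: strictly_faithful_iff_separating_polars[OF factor])
qed

end

context quantale_with_congruence
begin

lemma congruence_total_if_bottom_top:
  assumes "(\<bottom>, \<top>) \<in> \<theta>"
  shows "\<theta> = carrier Q \<times> carrier Q"
proof -
  have to_top: "(x, \<top>) \<in> \<theta>" if x: "x \<in> carrier Q" for x
  proof -
    have "(\<Squnion>{x, \<bottom>}, \<Squnion>{x, \<top>}) \<in> \<theta>"
      using cong_sup[of "{(x, x), (\<bottom>, \<top>)}"] assms cong_refl[OF x] by simp
    moreover have "\<Squnion>{x, \<bottom>} = x"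
      using x by (intro le_antisym) (simp_all add: pair_sup_le_iff sup_upper)
    moreover have "\<Squnion>{x, \<top>} = \<top>"
      using x by (intro le_antisym) (simp_all add: sup_upper)
    ultimately show ?thesis by simp
  qed
  have "(x, y) \<in> \<theta>" if "x \<in> carrier Q" "y \<in> carrier Q" for x y
    by (rule cong_trans[OF to_top[OF that(1)] cong_sym[OF to_top[OF that(2)]]])
  then have "carrier Q \<times> carrier Q \<subseteq> \<theta>"
    by auto
  then show ?thesis
    using cong_subset by (rule equalityI[rotated])
qed

lemma strictly_faithful_factor_congruence_cases:
  assumes sf: "strictly_faithful Q" and factor: "factor Q"
  shows "\<theta> = Id_on (carrier Q) \<or> \<theta> = carrier Q \<times> carrier Q"
proof (cases "\<theta> \<subseteq> Id_on (carrier Q)")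
  case True
  moreover have "Id_on (carrier Q) \<subseteq> \<theta>"
    using cong_refl by blast
  ultimately have "\<theta> = Id_on (carrier Q)"
    by (rule subset_antisym)
  then show ?thesis ..
next
  case False
  then obtain a b where ab: "(a, b) \<in> \<theta>" "(a, b) \<notin> Id_on (carrier Q)"
    by (meson subrelI)
  have a: "a \<in> carrier Q" and b: "b \<in> carrier Q"
    using cong_carrier[OF ab(1)] by simp_all
  have "a \<noteq> b"
    using ab(2) a by (simp add: Id_on_iff)
  then obtain l r where l: "l \<in> left_sided Q" and r: "r \<in> right_sided Q"
    and neq: "l \<otimes> a \<otimes> r \<noteq> l \<otimes> b \<otimes> r"
    using sf a b unfolding strictly_faithful_def by metis
  have "l \<in> carrier Q" "r \<in> carrier Q"
    using l r by (simp_all add: left_sided_def right_sided_def)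
  then have "(l \<otimes> a \<otimes> r, l \<otimes> b \<otimes> r) \<in> \<theta>"
    using ab(1) cong_mult_left cong_mult_right by blast
  moreover from this have "(l \<otimes> b \<otimes> r, l \<otimes> a \<otimes> r) \<in> \<theta>"
    by (rule cong_sym)
  ultimately have "(\<bottom>, \<top>) \<in> \<theta>"
    using factor_sandwich_cases[OF factor l a r] factor_sandwich_cases[OF factor l b r] neq
    by metis
  then show ?thesis
    by (simp add: congruence_total_if_bottom_top)
qed

end

context quantale
begin

theorem strictly_faithful_factor_imp_simple_quantale:
  assumes sf: "strictly_faithful Q" and factor: "factor Q"
  shows "simple_quantale Q"
proof -
  have "\<theta> = Id_on (carrier Q) \<or> \<theta> = carrier Q \<times> carrier Q"
    if "quantale_congruence Q \<theta>" for \<theta>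
  proof -
    interpret quantale_with_congruence Q \<theta>
      by unfold_locales (rule that)
    show ?thesis
      by (rule strictly_faithful_factor_congruence_cases[OF sf factor])
  qed
  then have "{\<theta>. quantale_congruence Q \<theta>} \<subseteq> {Id_on (carrier Q), carrier Q \<times> carrier Q}"
    by (intro subsetI) (simp only: mem_Collect_eq insert_iff empty_iff simp_thms)
  moreover have "{Id_on (carrier Q), carrier Q \<times> carrier Q} \<subseteq> {\<theta>. quantale_congruence Q \<theta>}"
    by (simp only: insert_subset empty_subsetI mem_Collect_eq quantale_congruence_Id
        quantale_congruence_total simp_thms)
  ultimately have "{\<theta>. quantale_congruence Q \<theta>} = {Id_on (carrier Q), carrier Q \<times> carrier Q}"
    by (rule subset_antisym)
  then show ?thesis
    using strictly_faithful_factor_top_mult_top[OF sf factor]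
    unfolding simple_quantale_iff_congruences by (rule conjI[rotated])
qed


section \<open>Separating cyclic sets\<close>

text \<open>
  Any polar that is not \<open>\<top>\<close> yields all the others as its residuals. If \<open>l \<otimes> \<top> \<otimes> r \<noteq> \<bottom>\<close>, then
  \<open>l \<otimes> \<top> = \<top>\<close> and \<open>\<top> \<otimes> r = \<top>\<close>, so the residual of \<open>r \<rightarrow> \<bottom> \<leftarrow> l\<close> by \<open>r' \<otimes> \<top>\<close> and \<open>\<top> \<otimes> l'\<close> is
  \<open>r' \<otimes> \<top> \<rightarrow> \<bottom> \<leftarrow> \<top> \<otimes> l'\<close>, and the outer factors \<open>\<top>\<close> do not affect which products vanish.
\<close>

theorem strictly_faithful_factor_cyclic_polars:
  assumes sf: "strictly_faithful Q" and factor: "factor Q"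
  shows "separating Q (polars - {\<top>})" and "cyclic Q (polars - {\<top>})"
proof -
  have nonzero: "\<top> \<otimes> \<top> \<noteq> \<bottom>"
    by (rule strictly_faithful_factor_top_mult_top[OF sf factor])
  have nontrivial: "\<bottom> \<noteq> \<top>"
    using factor unfolding factor_def by (rule conjunct2)
  have sep_polars: "separating Q polars"
    using sf by (simp add: strictly_faithful_iff_separating_polars[OF factor])
  show sep: "separating Q (polars - {\<top>})"
    unfolding separating_def
  proof (intro conjI ballI impI)
    show "polars - {\<top>} \<subseteq> carrier Q"
      using polars_closed by blast
    fix a b assume "a \<in> carrier Q" and b: "b \<in> carrier Q" and "\<not> b \<sqsubseteq> a"
    then obtain p where p: "p \<in> polars" "a \<sqsubseteq> p" "\<not> b \<sqsubseteq> p"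
      using sep_polars unfolding separating_def by blast
    moreover from this have "p \<noteq> \<top>"
      using top_higher[OF b] by auto
    ultimately show "\<exists>p\<in>polars - {\<top>}. a \<sqsubseteq> p \<and> \<not> b \<sqsubseteq> p"
      by blast
  qed
  show "cyclic Q (polars - {\<top>})"
    unfolding cyclic_def
  proof (intro conjI ballI)
    have "\<not> \<top> \<sqsubseteq> \<bottom>"
      using nontrivial by (simp add: le_bottom_iff)
    then show "polars - {\<top>} \<noteq> {}"
      using sep bottom_closed top_closed unfolding separating_def by blast
    fix p assume "p \<in> polars - {\<top>}"
    then have "p \<in> polars" "p \<noteq> \<top>" by simp_all
    obtain l r where l: "l \<in> left_sided Q" and r: "r \<in> right_sided Q"
      and lr: "l \<in> carrier Q" "r \<in> carrier Q" and p: "p = two_res r \<bottom> l"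
      using \<open>p \<in> polars\<close> by (rule polarE)
    have pos: "l \<otimes> \<top> \<otimes> r \<noteq> \<bottom>"
      using \<open>p \<noteq> \<top>\<close> lr top_le_iff[of p] by (auto simp: p le_two_res_bottom_iff)
    have "l \<otimes> \<top> \<in> two_sided Q" "\<top> \<otimes> r \<in> two_sided Q"
      using l r lr by (simp_all add: two_sided_def left_sided_mult top_mult_left_sided
          right_sided_mult mult_top_right_sided)
    then have lt: "l \<otimes> \<top> = \<top>" and tr: "\<top> \<otimes> r = \<top>"
      using pos factor mult_bottom_left[OF lr(2)] mult_bottom_right[OF lr(1)]
        mult_assoc[OF lr(1) top_closed lr(2)] unfolding factor_def by (metis insertE singletonD)+
    have residual: "two_res a p b = two_res (a \<otimes> r) \<bottom> (l \<otimes> b)"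
      if "a \<in> carrier Q" "b \<in> carrier Q" for a b
      using that lr by (simp add: p two_res_two_res)
    have "two_res a p b \<in> polars" if "a \<in> carrier Q" "b \<in> carrier Q" for a b
      using polarI[OF left_sided_mult[OF l that(2)] right_sided_mult[OF r that(1)]]
      by (simp add: residual[OF that])
    then have "{two_res a p b |a b. a \<in> carrier Q \<and> b \<in> carrier Q} \<subseteq> polars"
      by blast
    moreover have "x \<in> {two_res a p b |a b. a \<in> carrier Q \<and> b \<in> carrier Q}" if "x \<in> polars" for x
    proof -
      obtain l' r' where lr': "l' \<in> carrier Q" "r' \<in> carrier Q" and x: "x = two_res r' \<bottom> l'"
        using \<open>x \<in> polars\<close> by (rule polarE)
      have "two_res (r' \<otimes> \<top>) p (\<top> \<otimes> l') = two_res (r' \<otimes> (\<top> \<otimes> r)) \<bottom> (l \<otimes> \<top> \<otimes> l')"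
        using lr lr' by (simp add: residual mult_closed mult_assoc)
      also have "\<dots> = x"
        using factor_two_res_bottom_eq_polar[OF factor nonzero lr'(2,1)] by (simp add: lt tr x)
      finally have "x = two_res (r' \<otimes> \<top>) p (\<top> \<otimes> l')" ..
      moreover have "r' \<otimes> \<top> \<in> carrier Q" "\<top> \<otimes> l' \<in> carrier Q"
        using lr' by (simp_all add: mult_closed)
      ultimately show ?thesis by blast
    qed
    then have "polars \<subseteq> {two_res a p b |a b. a \<in> carrier Q \<and> b \<in> carrier Q}"
      by (rule subsetI)
    ultimately have "{two_res a p b |a b. a \<in> carrier Q \<and> b \<in> carrier Q} = polars"
      by (rule subset_antisym)
    moreover have "\<top> \<in> polars"
    proof -
      have "two_res \<bottom> \<bottom> \<top> = \<top>"
        by (rule eqI_lower) (simp_all add: le_two_res_bottom_iff mult_closed mult_bottom_right)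
      moreover have "\<bottom> \<in> right_sided Q"
        using bottom_two_sided by (simp add: two_sided_def)
      ultimately show ?thesis
        using polarI[OF top_left_sided, of \<bottom>] by simp
    qed
    ultimately show "{two_res a p b |a b. a \<in> carrier Q \<and> b \<in> carrier Q} = polars - {\<top>} \<union> {\<top>}"
      by (simp add: insert_absorb)
  qed (use polars_closed in auto)
qed

theorem separating_cyclic_imp_strictly_faithful_factor:
  assumes sep: "separating Q P" and cyc: "cyclic Q P"
  shows "strictly_faithful Q" and "factor Q"
proof -
  have P: "P \<subseteq> carrier Q" "\<top> \<notin> P" and "P \<noteq> {}"
    using cyc by (auto simp: cyclic_def)
  then obtain q where q: "q \<in> P" by blast
  have qc: "q \<in> carrier Q" using q P by auto
  have generate: "\<exists>a\<in>carrier Q. \<exists>b\<in>carrier Q. x = two_res a p b" if "p \<in> P" "x \<in> P" for p x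
    using cyc that unfolding cyclic_def by blast
  have residual: "two_res a p b \<in> P \<union> {\<top>}" if "p \<in> P" "a \<in> carrier Q" "b \<in> carrier Q" for p a b
    using cyc that unfolding cyclic_def by blast
  have "\<not> \<top> \<sqsubseteq> q"
    using q P by (auto simp: top_le_iff)
  then have nontrivial: "\<bottom> \<noteq> \<top>"
    using bottom_lower[OF qc] by auto
  \<comment> \<open>If \<open>t\<close> is below one \<open>p\<close> in \<open>P\<close>, then it is below every residual of \<open>p\<close>, so below all of \<open>P\<close>.\<close>
  have two_sided_bottom: "t = \<bottom>" if t: "t \<in> two_sided Q" and "t \<noteq> \<top>" for t
  proof -
    have tc: "t \<in> carrier Q"
      using t by (simp add: two_sided_def left_sided_def)
    have absorb: "b \<otimes> t \<otimes> a \<sqsubseteq> t" if "a \<in> carrier Q" "b \<in> carrier Q" for a b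
    proof -
      have "b \<otimes> t \<otimes> a \<sqsubseteq> t \<otimes> a"
        using that tc two_sided_mult_left[OF t] by (simp add: mult_mono_left mult_closed)
      then show ?thesis
        using that tc two_sided_mult_right[OF t that(1)] le_trans[of "b \<otimes> t \<otimes> a" "t \<otimes> a" t]
        by (simp add: mult_closed)
    qed
    have "\<not> \<top> \<sqsubseteq> t" using tc \<open>t \<noteq> \<top>\<close> by (simp add: top_le_iff)
    then obtain p where p: "p \<in> P" "t \<sqsubseteq> p"
      using sep tc unfolding separating_def by blast
    have pc: "p \<in> carrier Q" using p P by auto
    have "t \<sqsubseteq> x" if x: "x \<in> P" for x
    proof -
      obtain a b where ab: "a \<in> carrier Q" "b \<in> carrier Q" and x_eq: "x = two_res a p b"
        using generate[OF p(1) x] by blast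
      have "b \<otimes> t \<otimes> a \<sqsubseteq> p"
        using absorb[OF ab] p(2) ab tc pc le_trans[of "b \<otimes> t \<otimes> a" t p] by (simp add: mult_closed)
      then show ?thesis
        using ab tc pc by (simp add: x_eq le_two_res_iff)
    qed
    then have "t \<sqsubseteq> \<bottom>"
      using sep tc bottom_closed unfolding separating_def by blast
    then show ?thesis using tc by (simp add: le_bottom_iff)
  qed
  then show factor: "factor Q"
    using nontrivial bottom_two_sided top_two_sided unfolding factor_def by blast
  \<comment> \<open>A zero multiplication would make every residual equal to \<open>\<top>\<close>, but \<open>q\<close> is a residual.\<close>
  have nonzero: "\<top> \<otimes> \<top> \<noteq> \<bottom>"
  proof
    assume nil: "\<top> \<otimes> \<top> = \<bottom>"
    obtain a b where ab: "a \<in> carrier Q" "b \<in> carrier Q" and q_eq: "q = two_res a q b"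
      using generate[OF q q] by blast
    have "b \<otimes> \<top> \<sqsubseteq> \<top> \<otimes> \<top>"
      using ab by (simp add: mult_mono_left)
    then have "b \<otimes> \<top> = \<bottom>"
      using ab by (simp add: nil le_bottom_iff mult_closed)
    then have "b \<otimes> \<top> \<otimes> a \<sqsubseteq> q"
      using ab qc by (simp add: mult_bottom_left)
    then show False
      using \<open>\<not> \<top> \<sqsubseteq> q\<close> ab qc q_eq le_two_res_iff[of \<top> a q b] by simp
  qed
  have idem: "\<top> \<otimes> \<top> = \<top>"
    by (rule factor_top_idem[OF factor nonzero])
  \<comment> \<open>The residual \<open>\<top> \<rightarrow> q \<leftarrow> \<top>\<close> lies in \<open>P\<close> and is two-sided, which forces it to be \<open>\<bottom>\<close>.\<close>
  have bottom_in: "\<bottom> \<in> P"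
  proof -
    let ?m = "two_res \<top> q \<top>"
    have "?m \<noteq> \<top>"
      using \<open>\<not> \<top> \<sqsubseteq> q\<close> qc idem le_two_res_iff[of \<top> \<top> q \<top>] by auto
    moreover have "?m \<in> P \<union> {\<top>}"
      by (rule residual[OF q]) auto
    moreover have "?m \<in> two_sided Q"
      by (rule two_sided_two_res_top[OF idem qc])
    ultimately show ?thesis
      using two_sided_bottom by auto
  qed
  have "P \<subseteq> polars"
  proof
    fix x assume "x \<in> P"
    then obtain a b where ab: "a \<in> carrier Q" "b \<in> carrier Q" and x: "x = two_res a \<bottom> b"
      using generate[OF bottom_in] by blast
    show "x \<in> polars"
      using polarI[OF top_mult_left_sided[OF ab(2)] mult_top_right_sided[OF ab(1)]]
      by (simp add: x factor_two_res_bottom_eq_polar[OF factor nonzero ab])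
  qed
  then have "separating Q polars"
    using sep polars_closed unfolding separating_def by blast
  then show "strictly_faithful Q"
    by (simp add: strictly_faithful_iff_separating_polars[OF factor])
qed

end

theorem theorem2p5:
  fixes Q :: "('a, 'm) quantale_scheme"
  assumes "quantale Q"
  shows "(simple_quantale Q \<longleftrightarrow> strictly_faithful Q \<and> factor Q) \<and>
    (simple_quantale Q \<longleftrightarrow> (\<exists>P. separating Q P \<and> cyclic Q P))"
proof -
  interpret quantale Q by (rule assms)
  show ?thesis
    using simple_quantale_imp_factor simple_quantale_imp_strictly_faithful
      strictly_faithful_factor_imp_simple_quantale strictly_faithful_factor_cyclic_polars
      separating_cyclic_imp_strictly_faithful_factor
    by blast
qed

end
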